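(* There exists an absolute constant $C>0$ such that the following holds. Fix $\varepsilon>0$, $\delta\in(0,1)$ and $\sigma>0$. Let $G$ be a stable discrete-time SISO LTI system with stability radius $\rho\in(0,1)$, let $r\ge 1$ be an integer with $r\ge R(\varepsilon/2)$, and set $T=2r$. Take $m\ge 1$ input signals $u_1=\dots=u_m=e_1\in\mathbb{R}^T$ (which lie in the constraint set $\mathcal{U}=\{x\in\mathbb{R}^T:\|x\|_2\le 1\}$), where $$ m\ \ge\ C\,\frac{\sigma^2 r}{\varepsilon^2}\left(\log r+\log\left(\frac1\delta\right)\right). $$ Let $\widehat G_r$ be the length-$r$ FIR least-squares estimate computed from the $m$ independent noisy measurements corresponding to these inputs. Then, with probability at least $1-\delta$, $\|G-\widehat G_r\|_\infty\le\varepsilon$.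
   Context: System: $G(z)=\sum_{k\ge0}g_kz^{-k}$ with real impulse response $g=(g_k)_{k\ge0}$; "stable with stability radius $\rho\in(0,1)$" means $G$ is analytic on $\{|z|>\rho\}$ (all poles lie in $|z|\le\rho$). For a function $H$ analytic outside and continuous up to the unit circle $\mathbb{T}$, $\|H\|_\infty=\sup_{z\in\mathbb{T}}|H(z)|$ (the $\mathcal{H}_\infty$-norm); in particular $\|G(\gamma z)\|_\infty=\sup_{|z|=1}|G(\gamma z)|$. Sufficient length: for $\varepsilon>0$, $R(\varepsilon)$ is the smallest integer satisfying $$R(\varepsilon)\ \ge\ \inf_{\rho<\gamma<1}\frac{1}{1-\gamma}\log\left(\frac{\|G(\gamma z)\|_\infty}{\varepsilon(1-\gamma)}\right)$$ (with $\log 0=-\infty$; for an integer $r$, the condition $r\ge R(\varepsilon)$ just means that $r$ is at least this infimum). Measurements: for an input $u\in\mathbb{R}^T$ (indexed $0,\dots,T-1$) one observes $Y_{u,T}=((g\ast u)_k)_{k=0}^{T-1}+\xi\in\mathbb{R}^T$, with $\xi\sim N(0,\sigma^2I_T)$; noises of different measurements are independent. Estimator: $\mathrm{Toep}(u)$ is the $T\times T$ lower-triangular Toeplitz matrix with first column $u$. With $Z\in\mathbb{R}^{Tm\times T}$ obtained by stacking $\mathrm{Toep}(u_1),\dots,\mathrm{Toep}(u_m)$ vertically and $Y=(Y_{u_1,T},\dots,Y_{u_m,T})\in\mathbb{R}^{Tm}$, put $(\widehat g_0,\dots,\widehat g_{T-1})^{\top}=(Z^{\top}Z)^{-1}Z^{\top}Y$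 and $\widehat G_r(z)=\sum_{k=0}^{r-1}\widehat g_kz^{-k}$. $e_1$ is the first standard basis vector. *)

theory Defs
  imports
    "HOL-Complex_Analysis.Complex_Analysis"
    "HOL-Probability.Probability"
    "Jordan_Normal_Form.Gauss_Jordan_Elimination"
begin

hide_type (open) Finite_Cartesian_Product.vec
hide_const (open) Finite_Cartesian_Product.vec Determinants.det
unbundle no vec_syntax

section \<open>Stable systems\<close>

text \<open>
  A system is given by its impulse response \<open>g\<close> and its transfer function \<open>G\<close>. The expansion
  \<open>G z = (\<Sum>k. g k * z\<^sup>-\<^sup>k)\<close> is required only near infinity. Together with analyticity on the
  exterior of the disc of radius \<open>\<rho>\<close> it determines \<open>G\<close> there, and convergence of the series on
  that whole exterior is a consequence rather than an assumption. Values of \<open>G\<close> inside the disc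
  are irrelevant.
\<close>

definition stable_system :: "real \<Rightarrow> (nat \<Rightarrow> real) \<Rightarrow> (complex \<Rightarrow> complex) \<Rightarrow> bool" where
  "stable_system \<rho> g G \<longleftrightarrow>
     G analytic_on {z. norm z > \<rho>} \<and>
     (\<forall>\<^sub>F z in at_infinity. (\<lambda>k. complex_of_real (g k) / z ^ k) sums G z)"

text \<open>
  The supremum is real-valued, hence meaningful only for functions that are bounded on the unit
  circle, in particular for those that are continuous there.
\<close>

definition hinf_norm :: "(complex \<Rightarrow> complex) \<Rightarrow> real" where
  "hinf_norm H = (SUP z\<in>sphere 0 1. norm (H z))"

text \<open>
  The library's real logarithm has \<open>ln 0 = 0\<close>; here \<open>log 0 = -\<infinity>\<close>. Only arguments \<open>x \<ge> 0\<close> occur.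
\<close>

definition ext_ln :: "real \<Rightarrow> ereal" where
  "ext_ln x = (if x = 0 then -\<infinity> else ereal (ln x))"

text \<open>
  The infimum that defines the sufficient length \<open>R(\<epsilon>)\<close> (the least integer above it). It can be
  \<open>-\<infinity>\<close>, namely for the zero system, in which case there is no least such integer;
  for an integer \<open>r\<close>, the condition \<open>r \<ge> R(\<epsilon>)\<close> is \<open>sufficient_length_bound \<rho> G \<epsilon> \<le> r\<close>.
\<close>

definition sufficient_length_bound :: "real \<Rightarrow> (complex \<Rightarrow> complex) \<Rightarrow> real \<Rightarrow> ereal" where
  "sufficient_length_bound \<rho> G \<epsilon> =
     (INF \<gamma>\<in>{\<rho><..<1}. ereal (1 / (1 - \<gamma>)) *
        ext_ln (hinf_norm (\<lambda>z. G (complex_of_real \<gamma> * z)) / (\<epsilon> * (1 - \<gamma>))))"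

section \<open>Measurements\<close>

definition input_set :: "nat \<Rightarrow> real vec set" where
  "input_set T = {x \<in> carrier_vec T. sqrt (x \<bullet> x) \<le> 1}"

definition conv :: "(nat \<Rightarrow> real) \<Rightarrow> real vec \<Rightarrow> nat \<Rightarrow> real" where
  "conv g u k = (\<Sum>j | j \<le> k \<and> j < dim_vec u. g (k - j) * u $ j)"

definition measurement :: "(nat \<Rightarrow> real) \<Rightarrow> real vec \<Rightarrow> (nat \<Rightarrow> real) \<Rightarrow> real vec" where
  "measurement g u \<xi> = vec (dim_vec u) (\<lambda>k. conv g u k + \<xi> k)"

text \<open>
  \<open>gaussian_vector T \<sigma>\<close> is \<open>N(0, \<sigma>\<^sup>2 I\<^sub>T)\<close>; the second argument of \<^const>\<open>normal_density\<close> is the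
  standard deviation. A noise sample \<open>\<xi>\<close> has entries \<open>\<xi> i k\<close> with \<open>i < m\<close> the index of the
  measurement and \<open>k < T\<close> the time. Working with the joint law of the noise, instead of random
  variables on some \<open>M :: 'w measure\<close>, keeps a type variable out of statements about absolute
  constants, which could otherwise depend on \<open>'w\<close>. The lemma below shows that nothing is lost.
\<close>

definition gaussian_vector :: "nat \<Rightarrow> real \<Rightarrow> (nat \<Rightarrow> real) measure" where
  "gaussian_vector T \<sigma> = (\<Pi>\<^sub>M k\<in>{..<T}. density lborel (normal_density 0 \<sigma>))"

definition noise_law :: "nat \<Rightarrow> nat \<Rightarrow> real \<Rightarrow> (nat \<Rightarrow> nat \<Rightarrow> real) measure" where
  "noise_law m T \<sigma> = (\<Pi>\<^sub>M i\<in>{..<m}. gaussian_vector T \<sigma>)"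

lemma sets_gaussian_vector:
  "sets (gaussian_vector T \<sigma>) = sets (\<Pi>\<^sub>M k\<in>{..<T}. borel)"
  unfolding gaussian_vector_def by (intro sets_PiM_cong) auto

lemma (in prob_space) distr_independent_gaussian_vectors:
  assumes "m \<ge> 1"
    and indep: "indep_vars (\<lambda>_. gaussian_vector T \<sigma>) \<xi> {..<m}"
    and gauss: "\<And>i. i < m \<Longrightarrow> distr M (gaussian_vector T \<sigma>) (\<xi> i) = gaussian_vector T \<sigma>"
  shows "distr M (noise_law m T \<sigma>) (\<lambda>\<omega>. \<lambda>i\<in>{..<m}. \<xi> i \<omega>) = noise_law m T \<sigma>"
proof -
  have ne: "{..<m} \<noteq> {}" using \<open>m \<ge> 1\<close> by (auto simp: lessThan_empty_iff)
  have rv: "random_variable (gaussian_vector T \<sigma>) (\<xi> i)" if "i \<in> {..<m}" for i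
    using indep that by (auto simp: indep_vars_def)
  have "distr M (noise_law m T \<sigma>) (\<lambda>\<omega>. \<lambda>i\<in>{..<m}. \<xi> i \<omega>)
      = (\<Pi>\<^sub>M i\<in>{..<m}. distr M (gaussian_vector T \<sigma>) (\<xi> i))"
    using indep_vars_iff_distr_eq_PiM'[OF ne rv] indep by (simp add: noise_law_def)
  also have "\<dots> = noise_law m T \<sigma>"
    unfolding noise_law_def by (intro PiM_cong) (auto simp: gauss)
  finally show ?thesis .
qed

section \<open>The least-squares FIR estimator\<close>

definition Toep :: "real vec \<Rightarrow> real mat" where
  "Toep u = mat (dim_vec u) (dim_vec u) (\<lambda>(i, j). if j \<le> i then u $ (i - j) else 0)"

definition stacked_Toep :: "nat \<Rightarrow> nat \<Rightarrow> (nat \<Rightarrow> real vec) \<Rightarrow> real mat" where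
  "stacked_Toep m T u = mat (T * m) T (\<lambda>(i, j). Toep (u (i div T)) $$ (i mod T, j))"

definition stacked_measurements ::
  "nat \<Rightarrow> nat \<Rightarrow> (nat \<Rightarrow> real) \<Rightarrow> (nat \<Rightarrow> real vec) \<Rightarrow> (nat \<Rightarrow> nat \<Rightarrow> real) \<Rightarrow> real vec" where
  "stacked_measurements m T g u \<xi> =
     vec (T * m) (\<lambda>i. measurement g (u (i div T)) (\<xi> (i div T)) $ (i mod T))"

definition least_squares :: "real mat \<Rightarrow> real vec \<Rightarrow> real vec" where
  "least_squares Z Y = the (mat_inverse (Z\<^sup>T * Z)) *\<^sub>v (Z\<^sup>T *\<^sub>v Y)"

definition fir :: "nat \<Rightarrow> real vec \<Rightarrow> complex \<Rightarrow> complex" where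
  "fir r h z = (\<Sum>k<r. complex_of_real (h $ k) / z ^ k)"

definition G_hat ::
  "nat \<Rightarrow> nat \<Rightarrow> nat \<Rightarrow> (nat \<Rightarrow> real) \<Rightarrow> (nat \<Rightarrow> real vec) \<Rightarrow> (nat \<Rightarrow> nat \<Rightarrow> real) \<Rightarrow> complex \<Rightarrow> complex"
  where
  "G_hat r m T g u \<xi> =
     fir r (least_squares (stacked_Toep m T u) (stacked_measurements m T g u \<xi>))"

end

theory Submission
  imports Defs
begin

text \<open>
  Cauchy's inequality for \<open>w \<mapsto> G (1 / w)\<close> on the circle of radius \<open>1 / \<gamma>\<close> bounds \<open>g k\<close> by
  \<open>\<parallel>G(\<gamma>z)\<parallel> \<gamma>\<^sup>k\<close>; summing the tail and using \<open>\<gamma>\<^sup>r \<le> exp (- r (1 - \<gamma>))\<close>, the condition on \<open>r\<close> makes the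
  truncation error at most \<open>\<epsilon> / 2\<close>. For impulse inputs \<open>Z\<^sup>T Z = m I\<close>, so least squares averages
  the \<open>m\<close> measurements and the error of \<open>g k\<close> is the mean \<open>w k\<close> of the noise at time \<open>k\<close>. The
  polynomial with coefficients \<open>w\<close> is controlled on the unit circle by its coefficients together
  with its values on a grid of \<open>4 r\<^sup>2\<close> points; all of these are Gaussian with variance at most
  \<open>r \<sigma>\<^sup>2 / m\<close>, and a union bound finishes the proof. For \<open>r = 1\<close> the assumption on \<open>m\<close> becomes
  vacuous as \<open>\<delta>\<close> tends to 1, so there the Gaussian tail bound is needed without any constant factor.
\<close>

section \<open>Truncation\<close>

text \<open>Substituting w = 1/z turns the exterior of the disc into a disc around 0, where Cauchy's
  inequality and Taylor's theorem apply. The expansion near infinity identifies the Taylor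
  coefficients at 0; analyticity of \<open>G\<close> carries the function to the whole disc.\<close>

lemma stable_system_inversion:
  assumes G: "stable_system \<rho> g G" and "0 < \<rho>"
  obtains F where "F holomorphic_on ball 0 (1 / \<rho>)"
    and "\<And>k. (deriv ^^ k) F 0 / fact k = complex_of_real (g k)"
    and "\<And>z. norm z > \<rho> \<Longrightarrow> F (inverse z) = G z"
proof -
  \<comment> \<open>The value at 0 is the limit of \<open>G\<close> at infinity. It must be set by
    hand, since \<open>inverse 0 = 0\<close> would give the arbitrary value
    \<open>G 0\<close>.\<close>
  define F where "F w = (if w = 0 then complex_of_real (g 0) else G (inverse w))" for w
  obtain b where "b > 0"
    and b: "\<And>z. norm z \<ge> b \<Longrightarrow> (\<lambda>k. complex_of_real (g k) / z ^ k) sums G z"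
    using G unfolding stable_system_def eventually_at_infinity_pos by blast
  have near: "(\<lambda>k. complex_of_real (g k) * w ^ k) sums F w" if "w \<in> ball 0 (inverse b)" for w
  proof (cases "w = 0")
    case True
    then show ?thesis by (simp add: F_def)
  next
    case False
    then have "norm (inverse w) \<ge> b"
      using that \<open>b > 0\<close> by (simp add: norm_inverse norm_divide field_simps)
    from b[OF this] show ?thesis
      using False by (simp add: F_def divide_simps power_inverse)
  qed
  have "F holomorphic_on ball 0 (inverse b)"
    using near by (intro power_series_holomorphic[where a = "\<lambda>k. complex_of_real (g k)"]) simp
  moreover have "F holomorphic_on ball 0 (1 / \<rho>) - {0}"
  proof -
    have "G holomorphic_on {z. norm z > \<rho>}"
      using G by (simp add: stable_system_def analytic_imp_holomorphic)
    moreover have "inverse ` (ball 0 (1 / \<rho>) - {0}) \<subseteq> {z::complex. norm z > \<rho>}"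
      using \<open>0 < \<rho>\<close> by (auto simp: norm_inverse norm_divide divide_simps mult.commute)
    ultimately have "(G \<circ> inverse) holomorphic_on ball 0 (1 / \<rho>) - {0}"
      by (intro holomorphic_on_compose_gen[where t = "{z. norm z > \<rho>}"] holomorphic_intros) auto
    then show ?thesis
      by (rule holomorphic_transform) (auto simp: F_def)
  qed
  \<comment> \<open>The power series handles a neighbourhood of 0, the composition
    \<open>G \<circ> inverse\<close> the punctured disc; both sets are open and their union covers
    the disc.\<close>
  ultimately have "F holomorphic_on ball 0 (inverse b) \<union> (ball 0 (1 / \<rho>) - {0})"
    by (intro holomorphic_on_Un) auto
  then have hol: "F holomorphic_on ball 0 (1 / \<rho>)"
    by (rule holomorphic_on_subset) (use \<open>b > 0\<close> in auto)
  have "F has_fps_expansion Abs_fps (\<lambda>k. complex_of_real (g k))" (is "_ has_fps_expansion ?S")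
    unfolding has_fps_expansion_def
  proof
    \<comment> \<open>Any nonzero point of the small disc would do: convergence there bounds the
      radius of convergence from below by its modulus.\<close>
    have "norm (complex_of_real (inverse b / 2)) \<le> fps_conv_radius ?S"
      unfolding fps_conv_radius_def fps_nth_Abs_fps
      by (rule conv_radius_geI, rule sums_summable, rule near)
         (use \<open>b > 0\<close> in \<open>simp add: norm_divide norm_inverse\<close>)
    moreover have "norm (complex_of_real (inverse b / 2)) > 0"
      using \<open>b > 0\<close> by simp
    ultimately show "fps_conv_radius ?S > 0"
      by (metis ereal_less(2) less_le_trans)
    have "eventually (\<lambda>w. w \<in> ball 0 (inverse b)) (nhds (0::complex))"
      using \<open>b > 0\<close> by (intro eventually_nhds_in_open) auto
    then show "\<forall>\<^sub>F w in nhds 0. eval_fps ?S w = F w"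
      by eventually_elim (use near in \<open>simp add: eval_fps_def sums_iff\<close>)
  qed
  then have "(deriv ^^ k) F 0 / fact k = complex_of_real (g k)" for k
    using fps_nth_fps_expansion by force
  moreover have "F (inverse z) = G z" if "norm z > \<rho>" for z
    using that \<open>0 < \<rho>\<close> by (auto simp: F_def)
  ultimately show ?thesis using that hol by blast
qed

text \<open>The Taylor series of the inverted function converges on its whole disc of holomorphy, so
  the expansion known near infinity spreads to the entire exterior.\<close>

lemma stable_system_sums:
  assumes "stable_system \<rho> g G" "0 < \<rho>" "norm z > \<rho>"
  shows "(\<lambda>k. complex_of_real (g k) / z ^ k) sums G z"
proof -
  obtain F where F: "F holomorphic_on ball 0 (1 / \<rho>)"
      "\<And>k. (deriv ^^ k) F 0 / fact k = complex_of_real (g k)"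
      "\<And>z. norm z > \<rho> \<Longrightarrow> F (inverse z) = G z"
    using stable_system_inversion assms by metis
  have "inverse z \<in> ball 0 (1 / \<rho>)"
    using assms by (auto simp: norm_inverse norm_divide divide_simps mult.commute)
  from holomorphic_power_series[OF F(1) this] show ?thesis
    using F(2,3) assms by (simp add: power_inverse divide_inverse)
qed

lemma hinf_norm_bound:
  assumes "continuous_on (sphere 0 1) H" "norm z = 1"
  shows "norm (H z) \<le> hinf_norm H"
proof -
  have "bounded ((\<lambda>z. norm (H z)) ` sphere 0 1)"
    using assms by (intro compact_imp_bounded compact_continuous_image continuous_intros) auto
  then show ?thesis
    unfolding hinf_norm_def using assms by (intro cSUP_upper bounded_imp_bdd_above) auto
qed

lemma hinf_norm_leI:
  assumes "\<And>z. norm z = 1 \<Longrightarrow> norm (H z) \<le> B"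
  shows "hinf_norm H \<le> B"
  unfolding hinf_norm_def using assms by (intro cSUP_least) auto

lemma hinf_norm_le_iff:
  assumes "continuous_on (sphere 0 1) H"
  shows "hinf_norm H \<le> B \<longleftrightarrow> (\<forall>z. norm z = 1 \<longrightarrow> norm (H z) \<le> B)"
  using hinf_norm_bound[OF assms] hinf_norm_leI order_trans by metis

lemma stable_system_continuous_on:
  assumes "stable_system \<rho> g G" "\<And>z. z \<in> A \<Longrightarrow> norm z > \<rho>"
  shows "continuous_on A G"
proof -
  have "continuous_on {z. norm z > \<rho>} G"
    using assms
    by (intro holomorphic_on_imp_continuous_on analytic_imp_holomorphic)
       (simp add: stable_system_def)
  then show ?thesis
    by (rule continuous_on_subset) (use assms in auto)
qed

lemma stable_system_dilated_continuous_on: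
  assumes "stable_system \<rho> g G" "0 < \<rho>" "\<rho> < \<gamma>"
  shows "continuous_on (sphere 0 1) (\<lambda>z. G (complex_of_real \<gamma> * z))"
proof -
  have "continuous_on ((\<lambda>z. complex_of_real \<gamma> * z) ` sphere 0 1) G"
    using assms by (intro stable_system_continuous_on[OF assms(1)]) (auto simp: norm_mult)
  then show ?thesis
    by (rule continuous_on_compose2) (auto intro!: continuous_intros)
qed

lemma impulse_response_decay:
  assumes "stable_system \<rho> g G" "0 < \<rho>" "\<rho> < \<gamma>"
  shows "\<bar>g k\<bar> \<le> hinf_norm (\<lambda>z. G (complex_of_real \<gamma> * z)) * \<gamma> ^ k" (is "_ \<le> ?M * _")
proof -
  obtain F where F: "F holomorphic_on ball 0 (1 / \<rho>)"
      "\<And>k. (deriv ^^ k) F 0 / fact k = complex_of_real (g k)"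
      "\<And>z. norm z > \<rho> \<Longrightarrow> F (inverse z) = G z"
    using stable_system_inversion assms(1,2) by metis
  have \<gamma>: "\<gamma> > 0" "1 / \<gamma> < 1 / \<rho>" using assms by (auto simp: field_simps)
  have "norm ((deriv ^^ k) F 0) \<le> fact k * ?M / (1 / \<gamma>) ^ k"
  proof (rule Cauchy_inequality)
    show "F holomorphic_on ball 0 (1 / \<gamma>)"
      using F(1) by (rule holomorphic_on_subset) (use \<gamma> in auto)
    show "continuous_on (cball 0 (1 / \<gamma>)) F"
      using F(1)
      by (intro holomorphic_on_imp_continuous_on, elim holomorphic_on_subset) (use \<gamma> in auto)
    fix w :: complex assume "norm (0 - w) = 1 / \<gamma>"
    then have w: "norm w = 1 / \<gamma>" by simp
    \<comment> \<open>This is the point of the unit circle with 1/w = \<gamma> z, so the values of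
      \<open>F\<close> on the circle of radius 1/\<gamma> are values of the dilated \<open>G\<close>
      on the unit circle.\<close>
    define z where "z = inverse w / of_real \<gamma>"
    have z: "norm z = 1" "inverse w = of_real \<gamma> * z"
      using w \<gamma> by (auto simp: z_def norm_divide norm_inverse)
    have "F w = G (of_real \<gamma> * z)"
      using F(3)[of "inverse w"] z \<gamma> assms by (metis inverse_inverse_eq norm_mult norm_of_real
          mult.right_neutral abs_of_pos)
    then show "norm (F w) \<le> ?M"
      using hinf_norm_bound[OF stable_system_dilated_continuous_on[OF assms] z(1)] by simp
  qed (use \<gamma> in simp)
  moreover have "\<bar>g k\<bar> = norm ((deriv ^^ k) F 0) / fact k"
    using arg_cong[OF F(2), of norm] by (simp add: norm_divide)
  ultimately have "\<bar>g k\<bar> \<le> (fact k * ?M / (1 / \<gamma>) ^ k) / fact k"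
    by (metis divide_right_mono fact_ge_zero)
  then show ?thesis
    by (simp add: power_one_over)
qed

lemma impulse_response_tail:
  assumes "stable_system \<rho> g G" "0 < \<rho>" "\<rho> < \<gamma>" "\<gamma> < 1" "norm z = 1"
  shows "norm (G z - (\<Sum>k<r. complex_of_real (g k) / z ^ k))
           \<le> hinf_norm (\<lambda>z. G (complex_of_real \<gamma> * z)) * \<gamma> ^ r / (1 - \<gamma>)" (is "_ \<le> ?M * _ / _")
proof -
  let ?a = "\<lambda>k. complex_of_real (g k) / z ^ k"
  have "?a sums G z"
    using assms by (intro stable_system_sums[OF assms(1)]) auto
  then have tail: "(\<lambda>k. ?a (k + r)) sums (G z - (\<Sum>k<r. ?a k))"
    by (rule sums_split_initial_segment)
  have le: "norm (?a (k + r)) \<le> ?M * \<gamma> ^ r * \<gamma> ^ k" for k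
    using impulse_response_decay[OF assms(1-3), of "k + r"] assms(5)
    by (simp add: norm_divide norm_mult norm_power power_add mult_ac)
  have geo: "(\<lambda>k. ?M * \<gamma> ^ r * \<gamma> ^ k) sums (?M * \<gamma> ^ r * (1 / (1 - \<gamma>)))"
    using assms by (intro sums_mult geometric_sums) auto
  have "norm (\<Sum>k. ?a (k + r)) \<le> (\<Sum>k. ?M * \<gamma> ^ r * \<gamma> ^ k)"
    using le geo by (intro norm_suminf_le) (auto simp: sums_iff)
  then show ?thesis
    using tail geo by (simp add: sums_iff)
qed

lemma truncation_error:
  assumes "stable_system \<rho> g G" "0 < \<rho>" "\<eta> > 0" "norm z = 1"
    and r: "sufficient_length_bound \<rho> G \<eta> \<le> ereal (real r)"
  shows "norm (G z - (\<Sum>k<r. complex_of_real (g k) / z ^ k)) \<le> \<eta>" (is "?E \<le> _")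
proof -
  text \<open>The infimum over \<open>\<gamma>\<close> need not be attained, hence the slack \<open>e\<close>.\<close>
  have E: "?E \<le> \<eta> * exp e" if "e > 0" for e
  proof -
    have "sufficient_length_bound \<rho> G \<eta> < ereal (r + e)"
      using r by (rule le_less_trans) (use that in simp)
    then obtain \<gamma> where \<gamma>: "\<rho> < \<gamma>" "\<gamma> < 1"
      and less: "ereal (1 / (1 - \<gamma>)) *
        ext_ln (hinf_norm (\<lambda>z. G (complex_of_real \<gamma> * z)) / (\<eta> * (1 - \<gamma>))) < ereal (r + e)"
      unfolding sufficient_length_bound_def INF_less_iff by auto
    define M where "M = hinf_norm (\<lambda>z. G (complex_of_real \<gamma> * z))"
    have tail: "?E \<le> M * \<gamma> ^ r / (1 - \<gamma>)"
      unfolding M_def using assms \<gamma> by (intro impulse_response_tail) auto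
    have "M \<ge> 0"
      unfolding M_def
      using hinf_norm_bound[OF stable_system_dilated_continuous_on[OF assms(1,2) \<gamma>(1)], of 1]
      by (meson norm_ge_zero norm_one order_trans)
    show ?thesis
    proof (cases "M = 0")
      \<comment> \<open>Here the logarithm is \<open>-\<infinity>\<close> and \<open>less\<close>
        carries no information, but the tail itself is already 0.\<close>
      case True
      then have "?E \<le> 0" using tail by simp
      also have "\<dots> \<le> \<eta> * exp e" using \<open>\<eta> > 0\<close> by simp
      finally show ?thesis .
    next
      case False
      then have "M > 0" using \<open>M \<ge> 0\<close> by simp
      then have "1 / (1 - \<gamma>) * ln (M / (\<eta> * (1 - \<gamma>))) < r + e"
        using less \<gamma> \<open>\<eta> > 0\<close> by (simp add: ext_ln_def M_def[symmetric])
      then have "ln (M / (\<eta> * (1 - \<gamma>))) < (r + e) * (1 - \<gamma>)"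
        using \<gamma> by (simp add: field_simps)
      then have "M / (\<eta> * (1 - \<gamma>)) < exp ((r + e) * (1 - \<gamma>))"
        using \<open>M > 0\<close> \<open>\<eta> > 0\<close> \<gamma> by (metis divide_pos_pos exp_less_mono exp_ln mult_pos_pos diff_gt_0_iff_gt)
      then have M: "M / (1 - \<gamma>) \<le> \<eta> * exp ((r + e) * (1 - \<gamma>))"
        using \<open>\<eta> > 0\<close> \<gamma> by (simp add: field_simps)
      \<comment> \<open>This is \<open>1 + x \<le> exp x\<close> at x = \<gamma> - 1. In the product
        below, the exponents r (1 - \<gamma>) cancel and only the slack e (1 - \<gamma>)
        survives.\<close>
      have "\<gamma> ^ r \<le> exp (- (1 - \<gamma>)) ^ r"
        using \<gamma> assms exp_ge_add_one_self[of "- (1 - \<gamma>)"] by (intro power_mono) auto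
      also have "\<dots> = exp (- (r * (1 - \<gamma>)))"
        by (simp add: exp_of_nat_mult[symmetric] algebra_simps)
      finally have "M / (1 - \<gamma>) * \<gamma> ^ r \<le> \<eta> * exp ((r + e) * (1 - \<gamma>)) * exp (- (r * (1 - \<gamma>)))"
        using M \<gamma> assms \<open>\<eta> > 0\<close> by (intro mult_mono) auto
      also have "\<dots> = \<eta> * exp (e * (1 - \<gamma>))"
        by (simp add: exp_add[symmetric] algebra_simps)
      also have "\<dots> \<le> \<eta> * exp e"
        using \<open>\<eta> > 0\<close> that \<gamma> assms by (simp add: mult_le_cancel_left1)
      finally show ?thesis using tail by (simp add: field_simps)
    qed
  qed
  have "((\<lambda>e. \<eta> * exp e) \<longlongrightarrow> \<eta> * exp 0) (at_right 0)"
    by (intro tendsto_intros)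
  then have "?E \<le> \<eta> * exp 0"
    by (rule tendsto_lowerbound)
       (use E in \<open>auto simp: eventually_at_right_field intro: exI[of _ 1]\<close>)
  then show ?thesis by simp
qed

section \<open>Gaussian noise\<close>

text \<open>Independence means that the joint law is the product of the marginals; the joint law of
  all coordinates is the product measure itself.\<close>

lemma indep_vars_PiM_coordinates:
  assumes "I \<noteq> {}" and N: "\<And>i. i \<in> I \<Longrightarrow> prob_space (N i)"
  shows "prob_space.indep_vars (PiM I N) N (\<lambda>i \<omega>. \<omega> i) I"
proof -
  interpret prob_space "PiM I N" using N by (rule prob_space_PiM)
  \<comment> \<open>Points of the product space are extensional, so restricting them to
    \<open>I\<close> changes nothing.\<close>
  have "distr (PiM I N) (PiM I N) (\<lambda>x. \<lambda>i\<in>I. x i) = distr (PiM I N) (PiM I N) (\<lambda>x. x)"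
    by (intro distr_cong) (auto simp: space_PiM)
  also have "\<dots> = PiM I N" by simp
  also have "\<dots> = (\<Pi>\<^sub>M i\<in>I. distr (PiM I N) (N i) (\<lambda>\<omega>. \<omega> i))"
    using N by (intro PiM_cong) (auto simp: distr_PiM_component)
  finally show ?thesis
    using assms by (subst indep_vars_iff_distr_eq_PiM') auto
qed

text \<open>Applied twice: to the times within one measurement, then to the measurements. Summing
  over a subset \<open>J\<close> makes it possible to leave out coordinates with coefficient 0,
  whose law is degenerate and has no density.\<close>

lemma distributed_PiM_sum_normal:
  fixes f :: "'i \<Rightarrow> 'a \<Rightarrow> real"
  assumes "finite J" "J \<subseteq> I" "J \<noteq> {}"
    and N: "\<And>i. i \<in> I \<Longrightarrow> prob_space (N i)"
    and f: "\<And>i. i \<in> J \<Longrightarrow> distributed (N i) lborel (f i) (normal_density 0 (s i))"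
    and s: "\<And>i. i \<in> J \<Longrightarrow> 0 < s i"
  shows "distributed (PiM I N) lborel (\<lambda>x. \<Sum>i\<in>J. f i (x i))
           (normal_density 0 (sqrt (\<Sum>i\<in>J. (s i)\<^sup>2)))"
proof -
  interpret prob_space "PiM I N" using N by (rule prob_space_PiM)
  have meas: "f i \<in> borel_measurable (N i)" if "i \<in> J" for i
    using distributed_measurable[OF f[OF that]] by simp
  have "I \<noteq> {}" using assms by auto
  then have "indep_vars N (\<lambda>i \<omega>. \<omega> i) J"
    using indep_vars_PiM_coordinates[of I N] N \<open>J \<subseteq> I\<close> by (blast intro: indep_vars_subset)
  then have "indep_vars (\<lambda>_. borel) (\<lambda>i x. f i (x i)) J"
    by (rule indep_vars_compose2) (rule meas)
  moreover have "distributed (PiM I N) lborel (\<lambda>x. f i (x i)) (normal_density 0 (s i))"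
    if i: "i \<in> J" for i
  proof -
    have [measurable]: "f i \<in> borel_measurable (N i)" by (rule meas[OF i])
    have [measurable]: "(\<lambda>x. x i) \<in> measurable (PiM I N) (N i)"
      using i assms by (intro measurable_component_singleton) auto
    have "distr (PiM I N) lborel (\<lambda>x. f i (x i))
        = distr (distr (PiM I N) (N i) (\<lambda>x. x i)) lborel (f i)"
      by (subst distr_distr) (auto simp: comp_def)
    also have "\<dots> = distr (N i) lborel (f i)"
      using i assms by (subst distr_PiM_component) auto
    also have "\<dots> = density lborel (normal_density 0 (s i))"
      by (rule distributed_distr_eq_density[OF f[OF i]])
    finally show ?thesis by (simp add: distributed_def)
  qed
  ultimately show ?thesis
    using sum_indep_normal[of J "\<lambda>i x. f i (x i)" s "\<lambda>_. 0"] assms by simp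
qed

text \<open>
  Shifting each of the two tails by \<open>a\<close> to the origin costs the factor \<open>exp (- a\<^sup>2 / (2 s\<^sup>2))\<close>, and
  the shifted tails add up to at most the whole mass: unlike in the Chernoff bound, there is no
  factor 2 in front.
\<close>
lemma normal_tail:
  assumes X: "distributed M lborel X (normal_density 0 s)" and "s > 0" "a \<ge> 0"
  shows "emeasure M {x \<in> space M. a < \<bar>X x\<bar>} \<le> ennreal (exp (- a\<^sup>2 / (2 * s\<^sup>2)))"
proof -
  let ?\<phi> = "\<lambda>x. ennreal (normal_density 0 s x)"
  let ?e = "exp (- a\<^sup>2 / (2 * s\<^sup>2))"
  \<comment> \<open>Both tails come from this, with b = a and y > 0 or with b = -a and y < 0: the
    cross term 2 b y is nonnegative, so (b + y)^2 is at least a^2 + y^2.\<close>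
  have shift: "normal_density 0 s (b + y) \<le> ?e * normal_density 0 s y" if "b\<^sup>2 = a\<^sup>2" "b * y \<ge> 0" for b y
  proof -
    have "- (b + y)\<^sup>2 \<le> - a\<^sup>2 + - y\<^sup>2"
      using that by (simp add: power2_sum)
    then have "- (b + y)\<^sup>2 / (2 * s\<^sup>2) \<le> - a\<^sup>2 / (2 * s\<^sup>2) + - y\<^sup>2 / (2 * s\<^sup>2)"
      unfolding add_divide_distrib[symmetric] by (rule divide_right_mono) simp
    then have "exp (- (b + y)\<^sup>2 / (2 * s\<^sup>2)) \<le> ?e * exp (- y\<^sup>2 / (2 * s\<^sup>2))"
      unfolding exp_add[symmetric] by simp
    then show ?thesis
      using \<open>s > 0\<close> by (simp add: normal_density_def divide_right_mono)
  qed
  have "{x \<in> space M. a < \<bar>X x\<bar>} = X -` {x. a < \<bar>x\<bar>} \<inter> space M" by auto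
  then have "emeasure M {x \<in> space M. a < \<bar>X x\<bar>} = (\<integral>\<^sup>+x. ?\<phi> x * indicator {x. a < \<bar>x\<bar>} x \<partial>lborel)"
    using distributed_emeasure[OF X, of "{x. a < \<bar>x\<bar>}"] by simp
  also have "\<dots> = (\<integral>\<^sup>+x. ?\<phi> x * indicator {a<..} x + ?\<phi> x * indicator {..<-a} x \<partial>lborel)"
    using \<open>a \<ge> 0\<close> by (intro nn_integral_cong) (auto split: split_indicator)
  also have "\<dots> = (\<integral>\<^sup>+x. ?\<phi> x * indicator {a<..} x \<partial>lborel) + (\<integral>\<^sup>+x. ?\<phi> x * indicator {..<-a} x \<partial>lborel)"
    by (rule nn_integral_add) auto
  also have "(\<integral>\<^sup>+x. ?\<phi> x * indicator {a<..} x \<partial>lborel) = (\<integral>\<^sup>+y. ?\<phi> (a + y) * indicator {a<..} (a + y) \<partial>lborel)"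
    by (subst nn_integral_real_affine[where c = 1 and t = a]) auto
  also have "(\<integral>\<^sup>+x. ?\<phi> x * indicator {..<-a} x \<partial>lborel) = (\<integral>\<^sup>+y. ?\<phi> (- a + y) * indicator {..<-a} (- a + y) \<partial>lborel)"
    by (subst nn_integral_real_affine[where c = 1 and t = "- a"]) auto
  also have "(\<integral>\<^sup>+y. ?\<phi> (a + y) * indicator {a<..} (a + y) \<partial>lborel) + (\<integral>\<^sup>+y. ?\<phi> (- a + y) * indicator {..<-a} (- a + y) \<partial>lborel)
      = (\<integral>\<^sup>+y. ?\<phi> (a + y) * indicator {a<..} (a + y) + ?\<phi> (- a + y) * indicator {..<-a} (- a + y) \<partial>lborel)"
    by (rule nn_integral_add[symmetric]) auto
  also have "\<dots> \<le> (\<integral>\<^sup>+y. ennreal ?e * ?\<phi> y \<partial>lborel)"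
  proof (rule nn_integral_mono)
    fix y :: real
    \<comment> \<open>The shifted tails occupy the disjoint half-lines y > 0 and y < 0, so at most
      one summand is nonzero at each y.\<close>
    have "?\<phi> (a + y) \<le> ennreal ?e * ?\<phi> y" if "y > 0"
      using shift[of a y] that \<open>a \<ge> 0\<close> by (simp add: ennreal_mult'[symmetric] ennreal_leI)
    moreover have "?\<phi> (- a + y) \<le> ennreal ?e * ?\<phi> y" if "y < 0"
      using shift[of "- a" y] that \<open>a \<ge> 0\<close>
      by (simp add: ennreal_mult'[symmetric] ennreal_leI mult_nonneg_nonpos)
    ultimately show "?\<phi> (a + y) * indicator {a<..} (a + y) + ?\<phi> (- a + y) * indicator {..<-a} (- a + y)
        \<le> ennreal ?e * ?\<phi> y"
      by (auto split: split_indicator)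
  qed
  also have "\<dots> = ennreal ?e * (\<integral>\<^sup>+y. ?\<phi> y \<partial>lborel)"
    by (rule nn_integral_cmult) auto
  also have "(\<integral>\<^sup>+y. ?\<phi> y \<partial>lborel) = 1"
    using \<open>s > 0\<close> by (subst nn_integral_eq_integral) auto
  finally show ?thesis by simp
qed

section \<open>Linear functionals of the noise\<close>

lemma prob_space_gaussian_vector: "\<sigma> > 0 \<Longrightarrow> prob_space (gaussian_vector T \<sigma>)"
  unfolding gaussian_vector_def by (intro prob_space_PiM prob_space_normal_density)

lemma prob_space_noise_law: "\<sigma> > 0 \<Longrightarrow> prob_space (noise_law m T \<sigma>)"
  unfolding noise_law_def by (intro prob_space_PiM prob_space_gaussian_vector)

lemma measurable_noise_law_component:
  assumes "i < m" "k < T"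
  shows "(\<lambda>\<xi>. \<xi> i k) \<in> borel_measurable (noise_law m T \<sigma>)"
proof -
  have "(\<lambda>\<xi>. \<xi> i) \<in> measurable (noise_law m T \<sigma>) (gaussian_vector T \<sigma>)"
    unfolding noise_law_def using assms by (intro measurable_component_singleton) auto
  moreover have "(\<lambda>x. x k) \<in> measurable (gaussian_vector T \<sigma>) (density lborel (normal_density 0 \<sigma>))"
    unfolding gaussian_vector_def using assms by (intro measurable_component_singleton) auto
  ultimately have "(\<lambda>\<xi>. \<xi> i k) \<in> measurable (noise_law m T \<sigma>) (density lborel (normal_density 0 \<sigma>))"
    by (rule measurable_compose)
  then show ?thesis by simp
qed

text \<open>The double sum is centred Gaussian with variance m \<sigma>^2 times the sum of the
  squared coefficients, and the tail bound grows with the variance.\<close>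

lemma noise_functional_tail:
  assumes "m \<ge> 1" "\<sigma> > 0" "a \<ge> 0" "V > 0" and V: "(\<Sum>k<T. (c k)\<^sup>2) \<le> V"
  shows "measure (noise_law m T \<sigma>) {\<xi> \<in> space (noise_law m T \<sigma>). a < \<bar>\<Sum>i<m. \<Sum>k<T. c k * \<xi> i k\<bar>}
           \<le> exp (- a\<^sup>2 / (2 * (m * \<sigma>\<^sup>2 * V)))"
proof -
  interpret prob_space "noise_law m T \<sigma>" using assms by (intro prob_space_noise_law)
  interpret normal: prob_space "density lborel (normal_density 0 \<sigma>)"
    using assms by (intro prob_space_normal_density)
  \<comment> \<open>Vanishing coefficients are dropped because a normal density needs a positive
    standard deviation. If none remain, the functional is 0 and, as a \<ge> 0, the event is
    empty.\<close>
  define J where "J = {k. k < T \<and> c k \<noteq> 0}"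
  have J: "(\<Sum>k<T. c k * x k) = (\<Sum>k\<in>J. c k * x k)" for x
    unfolding J_def by (intro sum.mono_neutral_right) auto
  show ?thesis
  proof (cases "J = {}")
    case True
    then show ?thesis using assms by (simp add: J)
  next
    case False
    have "distributed (density lborel (normal_density 0 \<sigma>)) lborel (\<lambda>x. c k * x)
        (normal_density 0 (\<bar>c k\<bar> * \<sigma>))" if "k \<in> J" for k
    proof -
      have "distributed (density lborel (normal_density 0 \<sigma>)) lborel (\<lambda>x. x) (normal_density 0 \<sigma>)"
        by (auto simp: distributed_def intro!: measure_eqI)
           (auto simp: emeasure_distr)
      from normal.normal_density_affine[OF this, of "c k" 0] show ?thesis
        using that \<open>\<sigma> > 0\<close> by (simp add: J_def)
    qed
    then have "distributed (gaussian_vector T \<sigma>) lborel (\<lambda>x. \<Sum>k\<in>J. c k * x k)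
        (normal_density 0 (sqrt (\<Sum>k\<in>J. (\<bar>c k\<bar> * \<sigma>)\<^sup>2)))"
      unfolding gaussian_vector_def using False \<open>\<sigma> > 0\<close>
      by (intro distributed_PiM_sum_normal prob_space_normal_density) (auto simp: J_def)
    define v where "v = (\<Sum>k\<in>J. (\<bar>c k\<bar> * \<sigma>)\<^sup>2)"
    have "v > 0"
      unfolding v_def using False \<open>\<sigma> > 0\<close> by (intro sum_pos) (auto simp: J_def)
    have "v = \<sigma>\<^sup>2 * (\<Sum>k<T. (c k)\<^sup>2)"
      unfolding v_def sum_distrib_left
      by (intro sum.mono_neutral_cong_left) (auto simp: J_def power_mult_distrib)
    then have "v \<le> \<sigma>\<^sup>2 * V" using V by (simp add: mult_left_mono)
    have "distributed (noise_law m T \<sigma>) lborel (\<lambda>\<xi>. \<Sum>i<m. \<Sum>k\<in>J. c k * \<xi> i k)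
        (normal_density 0 (sqrt (\<Sum>i<m. (sqrt v)\<^sup>2)))"
      unfolding noise_law_def
    proof (rule distributed_PiM_sum_normal)
      fix i :: nat
      show "distributed (gaussian_vector T \<sigma>) lborel (\<lambda>x. \<Sum>k\<in>J. c k * x k) (normal_density 0 (sqrt v))"
        unfolding v_def by fact
    qed (use assms \<open>v > 0\<close> prob_space_gaussian_vector in \<open>auto simp: lessThan_empty_iff\<close>)
    moreover have "(\<Sum>i<m. (sqrt v)\<^sup>2) = m * v" using \<open>v > 0\<close> by simp
    ultimately have "emeasure (noise_law m T \<sigma>)
        {\<xi> \<in> space (noise_law m T \<sigma>). a < \<bar>\<Sum>i<m. \<Sum>k\<in>J. c k * \<xi> i k\<bar>}
          \<le> exp (- a\<^sup>2 / (2 * (sqrt (m * v))\<^sup>2))"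
      using assms \<open>v > 0\<close> by (intro normal_tail) auto
    then have "measure (noise_law m T \<sigma>) {\<xi> \<in> space (noise_law m T \<sigma>). a < \<bar>\<Sum>i<m. \<Sum>k<T. c k * \<xi> i k\<bar>}
          \<le> exp (- a\<^sup>2 / (2 * (m * v)))"
      using \<open>v > 0\<close> unfolding J emeasure_eq_measure by simp
    also have "\<dots> \<le> exp (- a\<^sup>2 / (2 * (m * \<sigma>\<^sup>2 * V)))"
    proof -
      have "a\<^sup>2 / (2 * (m * \<sigma>\<^sup>2 * V)) \<le> a\<^sup>2 / (2 * (m * v))"
        using \<open>v \<le> \<sigma>\<^sup>2 * V\<close> \<open>v > 0\<close> assms by (intro divide_left_mono) (auto simp: mult.assoc)
      then show ?thesis by simp
    qed
    finally show ?thesis .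
  qed
qed

section \<open>Least squares for impulse inputs\<close>

text \<open>Row q T + p of the stacked system belongs to measurement q at time p.\<close>

lemma sum_div_mod:
  fixes h :: "nat \<Rightarrow> nat \<Rightarrow> 'a::comm_monoid_add"
  shows "(\<Sum>i<T * m. h (i div T) (i mod T)) = (\<Sum>q<m. \<Sum>p<T. h q p)"
proof -
  have "(\<Sum>i<m * T. h (i div T) (i mod T))
      = (\<Sum>q<m. \<Sum>i\<in>{q * T..<q * T + T}. h (i div T) (i mod T))"
    by (rule sum.nat_group[symmetric])
  also have "\<dots> = (\<Sum>q<m. \<Sum>p<T. h q p)"
  proof (rule sum.cong[OF refl])
    fix q
    have "(\<Sum>i\<in>{q * T..<q * T + T}. h (i div T) (i mod T))
        = (\<Sum>p\<in>{0..<T}. h ((p + q * T) div T) ((p + q * T) mod T))"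
      using sum.shift_bounds_nat_ivl[of "\<lambda>i. h (i div T) (i mod T)" 0 "q * T" T]
      by (simp add: add.commute)
    also have "\<dots> = (\<Sum>p<T. h q p)"
      by (intro sum.cong) auto
    finally show "(\<Sum>i\<in>{q * T..<q * T + T}. h (i div T) (i mod T)) = (\<Sum>p<T. h q p)" .
  qed
  finally show ?thesis by (simp add: mult.commute)
qed

text \<open>\<open>mat_inverse\<close> is computed by elimination, so its value is reached through
  its specification: it succeeds on units of the matrix ring, and two-sided inverses are
  unique.\<close>

lemma mat_inverse_smult_one:
  fixes a :: "'a::field"
  assumes "a \<noteq> 0"
  shows "mat_inverse (a \<cdot>\<^sub>m 1\<^sub>m n) = Some (inverse a \<cdot>\<^sub>m 1\<^sub>m n)"
proof -
  let ?A = "a \<cdot>\<^sub>m 1\<^sub>m n" and ?B = "inverse a \<cdot>\<^sub>m 1\<^sub>m n"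
  have car: "?A \<in> carrier_mat n n" "?B \<in> carrier_mat n n" by auto
  have AB: "?A * ?B = 1\<^sub>m n" "?B * ?A = 1\<^sub>m n"
    using assms by (simp_all add: mult_smult_assoc_mat[of _ n n _ n] left_mult_one_mat[of _ n n])
      (auto intro!: eq_matI)
  then have "?A \<in> Units (ring_mat TYPE('a) n ())"
    using car by (auto simp: Units_def ring_mat_simps)
  then obtain B where B: "mat_inverse ?A = Some B"
    using mat_inverse(1)[OF car(1), where b = "()"] by (cases "mat_inverse ?A") auto
  from mat_inverse(2)[OF car(1) B] have "B * ?A = 1\<^sub>m n" "B \<in> carrier_mat n n" by auto
  moreover from this have "B * ?A * ?B = B * (?A * ?B)"
    using car by (intro assoc_mult_mat) auto
  ultimately have "B = ?B"
    using car unfolding AB(1) by (simp only: left_mult_one_mat right_mult_one_mat)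
  with B show ?thesis by simp
qed

lemma conv_impulse: "k < T \<Longrightarrow> conv g (unit_vec T 0) k = g k"
proof -
  assume "k < T"
  have "conv g (unit_vec T 0) k = (\<Sum>j\<in>{0}. g (k - j) * unit_vec T 0 $ j)"
    unfolding conv_def using \<open>k < T\<close> by (intro sum.mono_neutral_right) auto
  then show ?thesis using \<open>k < T\<close> by simp
qed

text \<open>The Toeplitz matrix of an impulse is the identity, so \<open>m\<close> identity blocks
  are stacked.\<close>

lemma stacked_Toep_impulse:
  assumes "\<forall>i<m. u i = unit_vec T 0" "i < T * m" "j < T"
  shows "stacked_Toep m T u $$ (i, j) = (if i mod T = j then 1 else 0)"
proof -
  have "i div T < m" using assms by (simp add: less_mult_imp_div_less mult.commute)
  moreover have "i mod T < T" "i mod T - j < T" using assms by (auto simp: less_imp_diff_less)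
  ultimately show ?thesis
    using assms by (auto simp: stacked_Toep_def Toep_def)
qed

lemma least_squares_impulse:
  assumes "m \<ge> 1" "\<forall>i<m. u i = unit_vec T 0" "k < T"
  shows "least_squares (stacked_Toep m T u) (stacked_measurements m T g u \<xi>) $ k
           = g k + (\<Sum>i<m. \<xi> i k) / m"
proof -
  define Z where "Z = stacked_Toep m T u"
  define Y where "Y = stacked_measurements m T g u \<xi>"
  have dim: "dim_row Z = T * m" "dim_col Z = T" "dim_vec Y = T * m"
    by (simp_all add: Z_def Y_def stacked_Toep_def stacked_measurements_def)
  have Z: "Z $$ (i, j) = (if i mod T = j then 1 else 0)" if "i < T * m" "j < T" for i j
    unfolding Z_def using stacked_Toep_impulse assms that by blast
  have "Z\<^sup>T * Z = real m \<cdot>\<^sub>m 1\<^sub>m T"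
  proof (rule eq_matI)
    fix a b assume "a < dim_row (real m \<cdot>\<^sub>m 1\<^sub>m T)" "b < dim_col (real m \<cdot>\<^sub>m 1\<^sub>m T)"
    then have ab: "a < T" "b < T" by auto
    have "(Z\<^sup>T * Z) $$ (a, b) = (\<Sum>i<T * m. Z $$ (i, a) * Z $$ (i, b))"
      using ab dim by (simp add: scalar_prod_def atLeast0LessThan)
    also have "\<dots> = (\<Sum>i<T * m. (\<lambda>q p. (if p = a then 1 else 0) * (if p = b then 1 else 0)) (i div T) (i mod T))"
      using ab by (intro sum.cong) (auto simp: Z)
    also have "\<dots> = (\<Sum>q<m. \<Sum>p<T. (if p = a then 1 else 0) * (if p = b then 1 else 0))"
      by (rule sum_div_mod)
    also have "\<dots> = (real m \<cdot>\<^sub>m 1\<^sub>m T) $$ (a, b)"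
      using ab by (simp add: if_distrib[of "\<lambda>x. x * _"] cong: if_cong)
    finally show "(Z\<^sup>T * Z) $$ (a, b) = (real m \<cdot>\<^sub>m 1\<^sub>m T) $$ (a, b)" .
  qed (use dim in auto)
  then have inv: "mat_inverse (Z\<^sup>T * Z) = Some (inverse (real m) \<cdot>\<^sub>m 1\<^sub>m T)"
    using mat_inverse_smult_one[of "real m" T] assms by simp
  have Y: "Y $ i = g (i mod T) + \<xi> (i div T) (i mod T)" if "i < T * m" for i
  proof -
    have "i div T < m" "i mod T < T"
      using that assms by (auto simp: less_mult_imp_div_less mult.commute)
    then show ?thesis
      using that assms by (simp add: Y_def stacked_measurements_def measurement_def conv_impulse)
  qed
  have "(Z\<^sup>T *\<^sub>v Y) $ k = (\<Sum>i<T * m. Z $$ (i, k) * Y $ i)"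
    using assms dim by (simp add: scalar_prod_def atLeast0LessThan)
  also have "\<dots> = (\<Sum>i<T * m. (\<lambda>q p. if p = k then g p + \<xi> q p else 0) (i div T) (i mod T))"
    using assms by (intro sum.cong) (auto simp: Z Y)
  also have "\<dots> = (\<Sum>q<m. \<Sum>p<T. if p = k then g p + \<xi> q p else 0)"
    by (rule sum_div_mod)
  also have "\<dots> = m * g k + (\<Sum>i<m. \<xi> i k)"
    using assms by (simp add: sum.distrib)
  finally have ZY: "(Z\<^sup>T *\<^sub>v Y) $ k = m * g k + (\<Sum>i<m. \<xi> i k)" .
  have "Z\<^sup>T *\<^sub>v Y \<in> carrier_vec T"
    by (rule mult_mat_vec_carrier[of _ _ "T * m"]) (use dim in \<open>auto intro: carrier_vecI\<close>)
  then have "least_squares Z Y $ k = inverse (real m) * (Z\<^sup>T *\<^sub>v Y) $ k"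
    using \<open>k < T\<close>
    by (simp add: least_squares_def inv row_smult scalar_prod_left_unit smult_scalar_prod_distrib[of _ T])
  then show ?thesis
    unfolding Z_def[symmetric] Y_def[symmetric] ZY using assms by (simp add: field_simps)
qed

section \<open>The noise polynomial on the unit circle\<close>

text \<open>A chord is no longer than its arc; a rotation reduces this to b = 0.\<close>

lemma norm_cis_diff_le: "norm (cis a - cis b) \<le> \<bar>a - b\<bar>"
proof -
  have "cis a - cis b = cis b * (cis (a - b) - 1)"
    by (simp add: algebra_simps cis_mult)
  then have "norm (cis a - cis b) = norm (cis (a - b) - 1)"
    by (simp add: norm_mult)
  also have "\<dots> \<le> \<bar>a - b\<bar>"
    using iexp_approx1[of "a - b" 0] by (simp add: cis_conv_exp)
  finally show ?thesis .
qed

text \<open>At a grid point the real and the imaginary part are each at most b in modulus, which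
  gives 2 b. The mesh is h = \<pi> / (2 r^2). By the coefficient bound, moving from z to a grid
  point at distance at most h changes each of the r terms by at most b r h, in total b \<pi> / 2
  \<le> 2 b.\<close>

lemma circle_grid_bound:
  fixes w :: "nat \<Rightarrow> real"
  assumes "r \<ge> 1" "norm z = 1"
    and coeff: "\<And>k. k < r \<Longrightarrow> \<bar>w k\<bar> \<le> b"
    and grid_cos: "\<And>j::nat. j < 4 * r\<^sup>2 \<Longrightarrow> \<bar>\<Sum>k<r. cos (k * (j * (pi / (2 * (real r)\<^sup>2)))) * w k\<bar> \<le> b"
    and grid_sin: "\<And>j::nat. j < 4 * r\<^sup>2 \<Longrightarrow> \<bar>\<Sum>k<r. sin (k * (j * (pi / (2 * (real r)\<^sup>2)))) * w k\<bar> \<le> b"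
  shows "norm (\<Sum>k<r. complex_of_real (w k) / z ^ k) \<le> 4 * b"
proof -
  define h where "h = pi / (2 * (real r)\<^sup>2)"
  define P where "P t = (\<Sum>k<r. complex_of_real (w k) * cis (- (k * t)))" for t :: real
  have "h > 0" using \<open>r \<ge> 1\<close> by (simp add: h_def)
  have "b \<ge> 0" using coeff[of 0] \<open>r \<ge> 1\<close> by (simp add: order_trans[OF abs_ge_zero])
  define t where "t = Arg2pi z"
  have t: "0 \<le> t" "t < 2 * pi" "z = cis t"
    unfolding t_def using Arg2pi[of z] \<open>norm z = 1\<close> by (auto simp: cis_conv_exp is_Arg_def)
  \<comment> \<open>The grid point just below the angle \<open>t\<close>; as 2 \<pi> / h = 4 r^2,
    its index is in range.\<close>
  define j where "j = nat \<lfloor>t / h\<rfloor>"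
  have "real j \<le> t / h" "t / h < real j + 1"
    unfolding j_def using t \<open>h > 0\<close> by auto
  then have th: "\<bar>t - j * h\<bar> \<le> h"
    using \<open>h > 0\<close> by (simp add: field_simps)
  have "t / h < 2 * pi / h"
    using t \<open>h > 0\<close> by (simp add: divide_strict_right_mono)
  also have "2 * pi / h = real (4 * r\<^sup>2)"
    using \<open>r \<ge> 1\<close> by (simp add: h_def field_simps)
  finally have "j < 4 * r\<^sup>2"
    using \<open>real j \<le> t / h\<close> by linarith
  have eq: "(\<Sum>k<r. complex_of_real (w k) / z ^ k) = P t"
    by (simp add: P_def t Complex.DeMoivre divide_inverse)
  have "Re (P (j * h)) = (\<Sum>k<r. cos (k * (j * h)) * w k)"
    by (simp add: P_def mult.commute)
  moreover have "Im (P (j * h)) = - (\<Sum>k<r. sin (k * (j * h)) * w k)"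
    by (simp add: P_def mult.commute sum_negf)
  ultimately have "norm (P (j * h)) \<le> 2 * b"
    using cmod_le[of "P (j * h)"] grid_cos[OF \<open>j < 4 * r\<^sup>2\<close>] grid_sin[OF \<open>j < 4 * r\<^sup>2\<close>]
    by (simp add: h_def)
  moreover have "norm (P t - P (j * h)) \<le> 2 * b"
  proof -
    have "norm (P t - P (j * h)) \<le> (\<Sum>k<r. b * (r * h))"
      unfolding P_def sum_subtractf[symmetric] right_diff_distrib[symmetric]
    proof (rule sum_norm_le)
      fix k assume "k \<in> {..<r}"
      have "norm (cis (- (k * t)) - cis (- (k * (j * h)))) \<le> \<bar>- (k * t) - - (k * (j * h))\<bar>"
        by (rule norm_cis_diff_le)
      also have "\<dots> = \<bar>- (k * (t - j * h))\<bar>"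
        by (simp add: algebra_simps)
      also have "\<dots> = k * \<bar>t - j * h\<bar>"
        by (simp add: abs_mult)
      also have "\<dots> \<le> r * h"
        using th \<open>k \<in> {..<r}\<close> by (intro mult_mono) auto
      finally show "norm (complex_of_real (w k) * (cis (- (k * t)) - cis (- (k * (j * h))))) \<le> b * (r * h)"
        using coeff[of k] \<open>k \<in> {..<r}\<close> \<open>b \<ge> 0\<close> unfolding norm_mult by (intro mult_mono) auto
    qed
    also have "\<dots> = b * (pi / 2)"
      using \<open>r \<ge> 1\<close> by (simp add: h_def power2_eq_square)
    also have "\<dots> \<le> b * 2"
      using \<open>b \<ge> 0\<close> pi_less_4 by (intro mult_left_mono) auto
    finally show ?thesis by simp
  qed
  ultimately show ?thesis
    unfolding eq using norm_triangle_ineq2[of "P t" "P (j * h)"] by linarith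
qed

text \<open>
  The bound on the number of functionals is \<open>r ^ 6\<close> because for \<open>r = 1\<close> it has to be exactly 1: the
  hypothesis on \<open>m\<close> then provides only \<open>ln (1 / \<delta>)\<close>, which may be arbitrarily small.
\<close>
lemma test_functionals:
  assumes "r \<ge> 1"
  obtains Cs :: "(nat \<Rightarrow> real) set" where "finite Cs" "card Cs \<le> r ^ 6"
    and "\<And>c. c \<in> Cs \<Longrightarrow> (\<Sum>k<r. (c k)\<^sup>2) \<le> r"
    and "\<And>w b z. norm z = 1 \<Longrightarrow> (\<And>c. c \<in> Cs \<Longrightarrow> \<bar>\<Sum>k<r. c k * w k\<bar> \<le> b) \<Longrightarrow>
      norm (\<Sum>k<r. complex_of_real (w k) / z ^ k) \<le> 4 * b"
proof (cases "r = 1")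
  case True
  \<comment> \<open>For r = 1 the polynomial is the constant \<open>w 0\<close>, so one functional
    suffices.\<close>
  show ?thesis
  proof (rule that[of "{\<lambda>_. 1}"])
    fix w :: "nat \<Rightarrow> real" and b and z :: complex
    assume "\<And>c. c \<in> {\<lambda>_. 1} \<Longrightarrow> \<bar>\<Sum>k<r. c k * w k\<bar> \<le> b"
    then have "\<bar>w 0\<bar> \<le> b" using True by simp
    then show "norm (\<Sum>k<r. complex_of_real (w k) / z ^ k) \<le> 4 * b" using True by simp
  qed (use True in auto)
next
  case False
  then have "r \<ge> 2" using assms by simp
  \<comment> \<open>\<open>D\<close> reads off the coefficients; \<open>C\<close> and
    \<open>S\<close> give the real part and, up to sign, the imaginary part at the grid
    points.\<close>
  define D where "D l = (\<lambda>k. if k = l then 1 else 0 :: real)" for l :: nat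
  define C where "C j = (\<lambda>k. cos (real k * (real j * (pi / (2 * (real r)\<^sup>2)))))" for j :: nat
  define S where "S j = (\<lambda>k. sin (real k * (real j * (pi / (2 * (real r)\<^sup>2)))))" for j :: nat
  let ?Cs = "D ` {..<r} \<union> C ` {..<4 * r\<^sup>2} \<union> S ` {..<4 * r\<^sup>2}"
  show ?thesis
  proof (rule that[of ?Cs])
    have "card ?Cs \<le> card (D ` {..<r}) + card (C ` {..<4 * r\<^sup>2}) + card (S ` {..<4 * r\<^sup>2})"
      by (intro order_trans[OF card_Un_le] add_mono card_Un_le order_refl)
    also have "\<dots> \<le> r + 4 * r\<^sup>2 + 4 * r\<^sup>2"
      by (intro add_mono order_trans[OF card_image_le]) auto
    \<comment> \<open>Rounded up to 16 = 2^4, which r^4 absorbs because r \<ge> 2.\<close>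
    also have "\<dots> \<le> 16 * r\<^sup>2"
      by (simp add: power2_eq_square)
    also have "\<dots> \<le> r ^ 4 * r\<^sup>2"
      using power_mono[OF \<open>r \<ge> 2\<close>, of 4] by (intro mult_right_mono) auto
    finally show "card ?Cs \<le> r ^ 6"
      by (simp add: power_add[symmetric])
  next
    fix c assume "c \<in> ?Cs"
    then have "(c k)\<^sup>2 \<le> 1" for k
      by (auto simp: D_def C_def S_def abs_square_le_1)
    then show "(\<Sum>k<r. (c k)\<^sup>2) \<le> r"
      using sum_bounded_above[of "{..<r}" "\<lambda>k. (c k)\<^sup>2" 1] by simp
  next
    fix w :: "nat \<Rightarrow> real" and b and z :: complex
    assume z: "norm z = 1" and le: "\<And>c. c \<in> ?Cs \<Longrightarrow> \<bar>\<Sum>k<r. c k * w k\<bar> \<le> b"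
    show "norm (\<Sum>k<r. complex_of_real (w k) / z ^ k) \<le> 4 * b"
    proof (rule circle_grid_bound[OF assms z])
      show "\<bar>w k\<bar> \<le> b" if "k < r" for k
        using le[of "D k"] that by (simp add: D_def if_distrib[of "\<lambda>x. x * _"] cong: if_cong)
      show "\<bar>\<Sum>k<r. cos (k * (j * (pi / (2 * (real r)\<^sup>2)))) * w k\<bar> \<le> b" if "j < 4 * r\<^sup>2" for j :: nat
        using le[of "C j"] that by (simp add: C_def)
      show "\<bar>\<Sum>k<r. sin (k * (j * (pi / (2 * (real r)\<^sup>2)))) * w k\<bar> \<le> b" if "j < 4 * r\<^sup>2" for j :: nat
        using le[of "S j"] that by (simp add: S_def)
    qed
  qed auto
qed

section \<open>Measurability of the error event\<close>

text \<open>Rational angles are dense, so by continuity a bound at countably many points controls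
  the supremum over the circle.\<close>

lemma continuous_circle_le_iff_rational_angles:
  fixes H :: "complex \<Rightarrow> complex"
  assumes "continuous_on (sphere 0 1) H"
  shows "(\<forall>z. norm z = 1 \<longrightarrow> norm (H z) \<le> B) \<longleftrightarrow> (\<forall>q\<in>\<rat>. norm (H (cis q)) \<le> B)"
proof
  assume le: "\<forall>q\<in>\<rat>. norm (H (cis q)) \<le> B"
  have "continuous_on (closure \<rat>) (\<lambda>t. norm (H (cis t)))"
    by (intro continuous_on_norm continuous_on_compose2[OF assms] continuous_intros) auto
  then have all: "norm (H (cis t)) \<le> B" for t
    using continuous_le_on_closure[of \<rat> "\<lambda>t. norm (H (cis t))" t B] le
    by (simp add: Rats_closure_real)
  show "\<forall>z. norm z = 1 \<longrightarrow> norm (H z) \<le> B"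
  proof safe
    fix z :: complex assume "norm z = 1"
    moreover from this have "z \<noteq> 0" by auto
    ultimately have "z = cis (Arg z)" using cis_Arg[of z] by (simp add: sgn_eq)
    then show "norm (H z) \<le> B" using all by metis
  qed
qed simp

lemma G_hat_impulse:
  assumes "m \<ge> 1" "\<forall>i<m. u i = unit_vec T 0" "r \<le> T"
  shows "G_hat r m T g u \<xi> z = (\<Sum>k<r. complex_of_real (g k) / z ^ k)
           + (\<Sum>k<r. complex_of_real ((\<Sum>i<m. \<xi> i k) / m) / z ^ k)"
  unfolding G_hat_def fir_def sum.distrib[symmetric]
  using assms by (intro sum.cong) (auto simp: least_squares_impulse add_divide_distrib)

lemma sets_hinf_error_le:
  assumes "stable_system \<rho> g G" "0 < \<rho>" "\<rho> < 1" "m \<ge> 1" "\<forall>i<m. u i = unit_vec T 0" "r \<le> T"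
  shows "{\<xi> \<in> space (noise_law m T \<sigma>). hinf_norm (\<lambda>z. G z - G_hat r m T g u \<xi> z) \<le> B}
           \<in> sets (noise_law m T \<sigma>)"
proof -
  have "continuous_on (sphere 0 1) (\<lambda>z. G z - G_hat r m T g u \<xi> z)" for \<xi>
    unfolding G_hat_def fir_def
    using assms by (intro continuous_intros stable_system_continuous_on[OF assms(1)]) auto
  then have "{\<xi> \<in> space (noise_law m T \<sigma>). hinf_norm (\<lambda>z. G z - G_hat r m T g u \<xi> z) \<le> B}
      = {\<xi> \<in> space (noise_law m T \<sigma>). \<forall>q\<in>\<rat>. norm (G (cis q) - G_hat r m T g u \<xi> (cis q)) \<le> B}"
    by (simp add: hinf_norm_le_iff continuous_circle_le_iff_rational_angles)
  also have "\<dots> \<in> sets (noise_law m T \<sigma>)"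
  proof (rule sets.sets_Collect_countable_All'[OF _ countable_rat])
    fix q :: real
    have mean: "(\<lambda>\<xi>. (\<Sum>i<m. \<xi> i k) / m) \<in> borel_measurable (noise_law m T \<sigma>)" if "k < r" for k
      using that assms(6)
      by (intro borel_measurable_divide borel_measurable_sum borel_measurable_const
          measurable_noise_law_component) auto
    have [measurable]: "(\<lambda>\<xi>. \<Sum>k<r. complex_of_real ((\<Sum>i<m. \<xi> i k) / m) / cis q ^ k)
        \<in> borel_measurable (noise_law m T \<sigma>)"
      by (intro borel_measurable_sum borel_measurable_divide borel_measurable_const
          measurable_compose[OF mean borel_measurable_of_real]) auto
    have "(\<lambda>\<xi>. norm (G (cis q) - G_hat r m T g u \<xi> (cis q))) \<in> borel_measurable (noise_law m T \<sigma>)"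
      unfolding G_hat_impulse[OF assms(4-6)] by measurable
    then show "{\<xi> \<in> space (noise_law m T \<sigma>). norm (G (cis q) - G_hat r m T g u \<xi> (cis q)) \<le> B}
        \<in> sets (noise_law m T \<sigma>)"
      by measurable
  qed
  finally show ?thesis .
qed

section \<open>Union bound and conclusion\<close>

lemma impulse_in_input_set: "T \<ge> 1 \<Longrightarrow> unit_vec T 0 \<in> input_set T"
  by (simp add: input_set_def)

text \<open>Truncation takes \<epsilon>/2, which leaves \<epsilon>/2 = 4 (\<epsilon>/8) for the
  noise, so each functional of the averaged noise may reach \<epsilon>/8. The exponent (m
  \<epsilon>/8)^2 / (2 m \<sigma>^2 r) equals m \<epsilon>^2 / (128 \<sigma>^2 r). It has to be at
  least 6 (ln r + ln (1/\<delta>)) to pay for r^6 functionals, hence 768 = 6 * 128.\<close>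

lemma hinf_error_probability:
  fixes \<delta> :: real
  assumes "\<epsilon> > 0" "0 < \<delta>" "\<delta> < 1" "\<sigma> > 0" "0 < \<rho>" "\<rho> < 1" and G: "stable_system \<rho> g G"
    and "r \<ge> 1" and R: "sufficient_length_bound \<rho> G (\<epsilon> / 2) \<le> ereal (real r)"
    and "r \<le> T" "m \<ge> 1" and u: "\<forall>i<m. u i = unit_vec T 0"
    and m: "768 * (\<sigma>\<^sup>2 * real r / \<epsilon>\<^sup>2) * (ln (real r) + ln (1 / \<delta>)) \<le> real m"
  shows "measure (noise_law m T \<sigma>)
    {\<xi> \<in> space (noise_law m T \<sigma>). hinf_norm (\<lambda>z. G z - G_hat r m T g u \<xi> z) \<le> \<epsilon>} \<ge> 1 - \<delta>"
    (is "measure ?N ?E \<ge> _")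
proof -
  interpret prob_space ?N using \<open>\<sigma> > 0\<close> by (rule prob_space_noise_law)
  obtain Cs :: "(nat \<Rightarrow> real) set" where Cs: "finite Cs" "card Cs \<le> r ^ 6"
      "\<And>c. c \<in> Cs \<Longrightarrow> (\<Sum>k<r. (c k)\<^sup>2) \<le> r"
      "\<And>w b z. norm z = 1 \<Longrightarrow> (\<And>c. c \<in> Cs \<Longrightarrow> \<bar>\<Sum>k<r. c k * w k\<bar> \<le> b) \<Longrightarrow>
        norm (\<Sum>k<r. complex_of_real (w k) / z ^ k) \<le> 4 * b"
    using test_functionals[OF \<open>r \<ge> 1\<close>] by blast
  \<comment> \<open>The noise has \<open>T\<close> entries per measurement, but only the first
    \<open>r\<close> enter the estimate; the coefficients are padded by 0.\<close>
  define ext where "ext c k = (if k < r then c k else 0)" for c :: "nat \<Rightarrow> real" and k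
  define bad where
    "bad c = {\<xi> \<in> space ?N. \<epsilon> / 8 * m < \<bar>\<Sum>i<m. \<Sum>k<T. ext c k * \<xi> i k\<bar>}" for c
  have bad_sets: "bad c \<in> sets ?N" for c
  proof -
    have [measurable]: "(\<lambda>\<xi>. \<Sum>i<m. \<Sum>k<T. ext c k * \<xi> i k) \<in> borel_measurable ?N"
      by (intro borel_measurable_sum borel_measurable_times borel_measurable_const
          measurable_noise_law_component) auto
    show ?thesis unfolding bad_def by measurable
  qed
  have "prob (bad c) \<le> exp (- 6 * (ln r + ln (1 / \<delta>)))" if "c \<in> Cs" for c
  proof -
    have "(\<Sum>k<T. (ext c k)\<^sup>2) = (\<Sum>k<r. (c k)\<^sup>2)"
      using \<open>r \<le> T\<close> by (intro sum.mono_neutral_cong_right) (auto simp: ext_def)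
    then have "prob (bad c) \<le> exp (- (\<epsilon> / 8 * m)\<^sup>2 / (2 * (m * \<sigma>\<^sup>2 * r)))"
      unfolding bad_def using Cs(3)[OF that] assms by (intro noise_functional_tail) auto
    also have "6 * (ln r + ln (1 / \<delta>)) \<le> (\<epsilon> / 8 * m)\<^sup>2 / (2 * (m * \<sigma>\<^sup>2 * r))"
      using m assms by (simp add: field_simps power2_eq_square)
    then have "exp (- (\<epsilon> / 8 * m)\<^sup>2 / (2 * (m * \<sigma>\<^sup>2 * r))) \<le> exp (- 6 * (ln r + ln (1 / \<delta>)))"
      by simp
    finally show ?thesis .
  qed
  then have "(\<Sum>c\<in>Cs. prob (bad c)) \<le> card Cs * exp (- 6 * (ln r + ln (1 / \<delta>)))"
    by (intro sum_bounded_above)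
  also have "\<dots> \<le> r ^ 6 * exp (- 6 * (ln r + ln (1 / \<delta>)))"
    using Cs(2) by (intro mult_right_mono) (auto simp flip: of_nat_power)
  \<comment> \<open>Each bad event has probability at most (\<delta>/r)^6, so the r^6
    cancels.\<close>
  also have "\<dots> = \<delta> ^ 6"
  proof -
    have "exp (- 6 * (ln r + ln (1 / \<delta>))) = exp (ln \<delta> - ln r) ^ 6"
      using \<open>\<delta> > 0\<close> by (simp add: exp_of_nat_mult[symmetric] ln_div)
    also have "exp (ln \<delta> - ln r) = \<delta> / r"
      using \<open>\<delta> > 0\<close> \<open>r \<ge> 1\<close> by (simp add: exp_diff)
    finally show ?thesis using \<open>r \<ge> 1\<close> by (simp add: power_divide)
  qed
  also have "\<dots> \<le> \<delta>"
    using power_decreasing[of 1 6 \<delta>] assms by simp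
  finally have "prob (\<Union>c\<in>Cs. bad c) \<le> \<delta>"
    using finite_measure_subadditive_finite[OF Cs(1), of bad] bad_sets by force
  then have "1 - \<delta> \<le> prob (space ?N - (\<Union>c\<in>Cs. bad c))"
    using Cs(1) bad_sets by (subst prob_compl) auto
  also have "\<dots> \<le> prob ?E"
  proof (rule finite_measure_mono)
    show "space ?N - (\<Union>c\<in>Cs. bad c) \<subseteq> ?E"
    proof
      fix \<xi> assume \<xi>: "\<xi> \<in> space ?N - (\<Union>c\<in>Cs. bad c)"
      define w where "w k = (\<Sum>i<m. \<xi> i k) / m" for k
      have w: "\<bar>\<Sum>k<r. c k * w k\<bar> \<le> \<epsilon> / 8" if "c \<in> Cs" for c
      proof -
        have "(\<Sum>i<m. \<Sum>k<T. ext c k * \<xi> i k) = (\<Sum>k<T. \<Sum>i<m. ext c k * \<xi> i k)"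
          by (rule sum.swap)
        also have "\<dots> = (\<Sum>k<r. \<Sum>i<m. c k * \<xi> i k)"
          using \<open>r \<le> T\<close> by (intro sum.mono_neutral_cong_right) (auto simp: ext_def)
        also have "\<dots> = m * (\<Sum>k<r. c k * w k)"
          unfolding sum_distrib_left using \<open>m \<ge> 1\<close>
          by (intro sum.cong refl) (simp add: w_def sum_distrib_left[symmetric])
        finally have "m * \<bar>\<Sum>k<r. c k * w k\<bar> \<le> \<epsilon> / 8 * m"
          using \<xi> that by (auto simp: bad_def abs_mult not_less)
        then show ?thesis using \<open>m \<ge> 1\<close> by (simp add: field_simps)
      qed
      have "hinf_norm (\<lambda>z. G z - G_hat r m T g u \<xi> z) \<le> \<epsilon>"
      proof (rule hinf_norm_leI)
        fix z :: complex assume z: "norm z = 1"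
        have "norm (G z - G_hat r m T g u \<xi> z)
            = norm ((G z - (\<Sum>k<r. complex_of_real (g k) / z ^ k)) - (\<Sum>k<r. complex_of_real (w k) / z ^ k))"
          unfolding G_hat_impulse[OF \<open>m \<ge> 1\<close> u \<open>r \<le> T\<close>] w_def by (simp add: algebra_simps)
        also have "\<dots> \<le> \<epsilon> / 2 + 4 * (\<epsilon> / 8)"
          using truncation_error[OF G \<open>0 < \<rho>\<close> _ z R] Cs(4)[OF z w] \<open>\<epsilon> > 0\<close>
          by (intro order_trans[OF norm_triangle_ineq4 add_mono]) auto
        finally show "norm (G z - G_hat r m T g u \<xi> z) \<le> \<epsilon>" by simp
      qed
      with \<xi> show "\<xi> \<in> ?E" by simp
    qed
    \<comment> \<open>Without this the bound could fail, since \<open>measure\<close> assigns 0 to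
      non-measurable sets.\<close>
    show "?E \<in> sets ?N"
      using assms by (intro sets_hinf_error_le[OF G]) auto
  qed
  finally show ?thesis .
qed

theorem theorem1p2:
  shows "\<exists>C::real. C > 0 \<and>
    (\<forall>(\<epsilon>::real) (\<delta>::real) (\<sigma>::real) (\<rho>::real) (g :: nat \<Rightarrow> real) (G :: complex \<Rightarrow> complex)
      (r::nat) (T::nat) (m::nat) (u :: nat \<Rightarrow> real vec).
        \<epsilon> > 0 \<longrightarrow> 0 < \<delta> \<longrightarrow> \<delta> < 1 \<longrightarrow> \<sigma> > 0 \<longrightarrow> 0 < \<rho> \<longrightarrow> \<rho> < 1 \<longrightarrow>
        stable_system \<rho> g G \<longrightarrow>
        r \<ge> 1 \<longrightarrow> ereal (real r) \<ge> sufficient_length_bound \<rho> G (\<epsilon> / 2) \<longrightarrow> T = 2 * r \<longrightarrow>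
        m \<ge> 1 \<longrightarrow> (\<forall>i<m. u i = unit_vec T 0) \<longrightarrow>
        real m \<ge> C * (\<sigma>\<^sup>2 * real r / \<epsilon>\<^sup>2) * (ln (real r) + ln (1 / \<delta>)) \<longrightarrow>
        (\<forall>i<m. u i \<in> input_set T) \<and>
        \<P>(\<xi> in noise_law m T \<sigma>. hinf_norm (\<lambda>z. G z - G_hat r m T g u \<xi> z) \<le> \<epsilon>) \<ge> 1 - \<delta>)"
  by (intro exI[of _ 768] conjI allI impI hinf_error_probability)
     (auto simp: impulse_in_input_set)

end
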